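(* Let $a$ be a positive integer. Then for every positive integer $n>14.4a$ there exist prime numbers $p$ and $q$ such that $n<ap<\frac{3n}{2}<aq<2n$.
   Context: All inequalities are strict. *)

theory Defs
  imports Complex_Main "HOL-Computational_Algebra.Primes"
begin

end

theory Submission
  imports Defs "HOL-Number_Theory.Prime_Powers" "HOL-Number_Theory.Pocklington"
    "HOL-Analysis.Harmonic_Numbers"
begin

text \<open>
  With \<open>x = n / a > 14.4\<close> the claim asks for primes in the open intervals from \<open>x\<close> to \<open>3x/2\<close> and
  from \<open>3x/2\<close> to \<open>2x\<close>; the second is the interval from \<open>y\<close> to \<open>4y/3\<close> for \<open>y = 3x/2\<close>.
  Chebyshev's combination \<open>n! \<lfloor>n/30\<rfloor>! / (\<lfloor>n/2\<rfloor>! \<lfloor>n/3\<rfloor>! \<lfloor>n/5\<rfloor>!)\<close> has a logarithm that lies between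
  \<open>\<psi>(n) - \<psi>(n/6)\<close> and \<open>\<psi>(n)\<close> and differs from \<open>A n\<close>, where \<open>A = 0.921...\<close>, by at most \<open>5 sqrt n\<close>.
  So \<open>\<psi>(n)\<close> lies between \<open>A n\<close> and \<open>(6/5) A n\<close> up to multiples of \<open>sqrt n\<close>, and since \<open>4/3 > 6/5\<close>,
  the difference \<open>\<psi>(4y/3) - \<psi>(y)\<close> grows linearly, whereas the proper prime powers contribute at most
  \<open>sqrt n ln n\<close> to \<open>\<psi>(n)\<close>. For smaller \<open>y\<close> a chain of primes with consecutive ratios less than \<open>4/3\<close>
  suffices.
\<close>

section \<open>Chebyshev's functions\<close>

definition chebyshev_psi :: "nat \<Rightarrow> real" where
  "chebyshev_psi n = (\<Sum>d=1..n. mangoldt d)"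

definition chebyshev_theta :: "nat \<Rightarrow> real" where
  "chebyshev_theta n = (\<Sum>p | prime p \<and> p \<le> n. ln (real p))"

lemma chebyshev_psi_diff:
  assumes "m \<le> n"
  shows "chebyshev_psi n - chebyshev_psi m = (\<Sum>d\<in>{m<..n}. mangoldt d)"
proof -
  have "{m<..n} = {1..n} - {1..m}" by auto
  then show ?thesis using assms by (simp add: chebyshev_psi_def sum_diff)
qed

lemma chebyshev_theta_le_if_no_prime_between:
  assumes "\<And>p. m < p \<Longrightarrow> p \<le> n \<Longrightarrow> \<not> prime p"
  shows "chebyshev_theta n \<le> chebyshev_theta m"
  unfolding chebyshev_theta_def
proof (rule sum_mono2)
  show "{p. prime p \<and> p \<le> n} \<subseteq> {p. prime p \<and> p \<le> m}"
    using assms by (auto simp: not_less [symmetric])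
qed (auto simp: prime_ge_1_nat)

lemma chebyshev_psi_minus_theta:
  "chebyshev_psi n - chebyshev_theta n = (\<Sum>d | d \<in> {1..n} \<and> \<not> prime d. mangoldt d)"
proof -
  have "{d. d \<in> {1..n} \<and> \<not> prime d} = {1..n} - {p. prime p \<and> p \<le> n}" by auto
  moreover have "{p. prime p \<and> p \<le> n} \<subseteq> {1..n}" by (auto simp: Suc_le_eq prime_gt_0_nat)
  ultimately show ?thesis by (simp add: chebyshev_psi_def chebyshev_theta_def sum_diff)
qed

lemma chebyshev_theta_le_psi: "chebyshev_theta n \<le> chebyshev_psi n"
proof -
  have "0 \<le> chebyshev_psi n - chebyshev_theta n"
    unfolding chebyshev_psi_minus_theta by (intro sum_nonneg mangoldt_nonneg)
  then show ?thesis by simp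
qed

lemma sum_mangoldt_multiples_of_prime_le_ln:
  assumes "prime p" "n > 0"
  shows "(\<Sum>d | d \<in> {1..n} \<and> p dvd d. mangoldt d) \<le> ln n"
proof -
  obtain k where power_bounds: "p ^ k \<le> n" "n < p ^ (k + 1)"
    using ex_power_ivl1[of p n] assms prime_ge_2_nat[OF \<open>prime p\<close>] by auto
  have dvd_power: "d dvd p ^ k" if "d \<in> {1..n}" "p dvd d" "primepow d" for d
  proof -
    obtain q j where "prime q" and d_eq: "d = q ^ j"
      using \<open>primepow d\<close> by (auto simp: primepow_def)
    with that assms(1) have "q = p" using prime_dvd_power primes_dvd_imp_eq by blast
    then have "p ^ j < p ^ (k + 1)" using that power_bounds(2) d_eq by simp
    then have "j < k + 1"
      using prime_gt_1_nat[OF assms(1)] by (intro power_less_imp_less_exp) auto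
    then show ?thesis using d_eq \<open>q = p\<close> by (simp add: le_imp_power_dvd)
  qed
  have "p ^ k > 0" using prime_gt_0_nat[OF assms(1)] by simp
  have "(\<Sum>d | d \<in> {1..n} \<and> p dvd d. mangoldt d :: real)
      = (\<Sum>d | d \<in> {1..n} \<and> p dvd d \<and> primepow d. mangoldt d)"
    by (intro sum.mono_neutral_right) (auto simp: mangoldt_def)
  also have "\<dots> \<le> (\<Sum>d | d dvd p ^ k. mangoldt d)"
    using dvd_power \<open>p ^ k > 0\<close> by (intro sum_mono2) (auto simp: mangoldt_nonneg)
  also have "\<dots> = ln (real (p ^ k))"
    using mangoldt_sum[of "p ^ k", where ?'a = real] \<open>p ^ k > 0\<close> by simp
  also have "\<dots> \<le> ln n"
    using power_bounds(1) \<open>p ^ k > 0\<close> \<open>n > 0\<close>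
    by (subst ln_le_cancel_iff) (auto simp del: of_nat_power)
  finally show ?thesis .
qed

lemma aprimedivisor_power2_le_if_not_prime:
  fixes d :: nat
  assumes "primepow d" "\<not> prime d"
  shows "(aprimedivisor d)\<^sup>2 \<le> d"
proof -
  obtain p k where "prime p" "k > 0" and d_eq: "d = p ^ k"
    using assms(1) by (auto simp: primepow_def)
  then have "k \<noteq> 1" using assms(2) by auto
  with \<open>k > 0\<close> \<open>prime p\<close> have "p\<^sup>2 \<le> p ^ k"
    using prime_ge_1_nat by (intro power_increasing) auto
  then show ?thesis using \<open>prime p\<close> \<open>k > 0\<close> by (simp add: d_eq aprimedivisor_prime_power)
qed

lemma card_primes_power2_le:
  fixes n :: nat
  shows "real (card {p :: nat. prime p \<and> p\<^sup>2 \<le> n}) \<le> sqrt n"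
proof -
  have "p \<in> {1..nat \<lfloor>sqrt n\<rfloor>}" if "prime p" "p\<^sup>2 \<le> n" for p :: nat
  proof -
    have "real p \<le> sqrt n" using that(2) by (metis of_nat_le_iff of_nat_power real_le_rsqrt)
    then show ?thesis using prime_ge_1_nat[OF that(1)] by (simp add: le_nat_floor)
  qed
  then have "card {p :: nat. prime p \<and> p\<^sup>2 \<le> n} \<le> card {1..nat \<lfloor>sqrt n\<rfloor>}"
    by (intro card_mono) auto
  also have "real (card {1..nat \<lfloor>sqrt n\<rfloor>}) \<le> sqrt n" by simp
  finally show ?thesis by simp
qed

lemma chebyshev_psi_minus_theta_le: "chebyshev_psi n - chebyshev_theta n \<le> sqrt n * ln n"
proof (cases "n = 0")
  case True
  then show ?thesis by (simp add: chebyshev_psi_def chebyshev_theta_def)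
next
  case False
  define N where "N = {d \<in> {1..n}. \<not> prime d \<and> primepow d}"
  define P where "P = {p :: nat. prime p \<and> p\<^sup>2 \<le> n}"
  have "finite N" by (simp add: N_def)
  have "finite P"
    by (rule finite_subset[of _ "{..n}"]) (auto simp: P_def power2_nat_le_imp_le)
  have "aprimedivisor ` N \<subseteq> P"
    using aprimedivisor_power2_le_if_not_prime
    by (auto simp: N_def P_def dest: primepow_gt_Suc_0 intro: prime_aprimedivisor' order_trans)
  have "chebyshev_psi n - chebyshev_theta n = (\<Sum>d\<in>N. mangoldt d)"
    unfolding chebyshev_psi_minus_theta N_def
    by (intro sum.mono_neutral_right) (auto simp: mangoldt_def)
  also have "\<dots> = (\<Sum>p\<in>P. \<Sum>d | d \<in> N \<and> aprimedivisor d = p. mangoldt d)"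
    by (rule sum.group [symmetric]) fact+
  also have "\<dots> \<le> (\<Sum>p\<in>P. ln n)"
  proof (rule sum_mono)
    fix p assume "p \<in> P"
    then have "prime p" by (simp add: P_def)
    have "(\<Sum>d | d \<in> N \<and> aprimedivisor d = p. mangoldt d :: real)
        \<le> (\<Sum>d | d \<in> {1..n} \<and> p dvd d. mangoldt d)"
      by (intro sum_mono2) (auto simp: N_def mangoldt_nonneg intro: aprimedivisor_dvd'
          dest: primepow_gt_Suc_0)
    also have "\<dots> \<le> ln n"
      using \<open>prime p\<close> False by (intro sum_mangoldt_multiples_of_prime_le_ln) auto
    finally show "(\<Sum>d | d \<in> N \<and> aprimedivisor d = p. mangoldt d) \<le> ln n" .
  qed
  also have "\<dots> = card P * ln n" by simp
  also have "\<dots> \<le> sqrt n * ln n"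
    using card_primes_power2_le[of n] False unfolding P_def by (intro mult_right_mono) auto
  finally show ?thesis .
qed

lemma ex_prime_between_if_chebyshev_psi_diff_greater:
  assumes "sqrt n * ln n < chebyshev_psi n - chebyshev_psi m"
  shows "\<exists>p. prime p \<and> m < p \<and> p \<le> n"
proof (rule ccontr)
  assume "\<not> ?thesis"
  then have "chebyshev_theta n \<le> chebyshev_theta m"
    by (intro chebyshev_theta_le_if_no_prime_between) auto
  with chebyshev_psi_minus_theta_le[of n] chebyshev_theta_le_psi[of m] assms
  show False by linarith
qed

section \<open>Chebyshev's factorial combination\<close>

lemma ln_fact_eq_sum_mangoldt:
  assumes "n \<le> N"
  shows "ln (fact n) = (\<Sum>d=1..N. mangoldt d * real (n div d))"
  using assms
proof (induction n)
  case 0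
  then show ?case by simp
next
  case (Suc n)
  have "ln (fact (Suc n)) = ln (real (Suc n)) + ln (fact n :: real)"
    by (simp add: ln_mult del: of_nat_Suc)
  also have "ln (real (Suc n)) = (\<Sum>d | d dvd Suc n. mangoldt d)"
    using mangoldt_sum[of "Suc n", where ?'a = real] by simp
  also have "\<dots> = (\<Sum>d=1..N. if d dvd Suc n then mangoldt d else 0)"
    using dvd_imp_le[of _ "Suc n"] dvd_pos_nat[of "Suc n"] order_trans[OF _ Suc.prems]
    by (intro sum.mono_neutral_cong_left) (auto simp: Suc_le_eq)
  also have "ln (fact n :: real) = (\<Sum>d=1..N. mangoldt d * real (n div d))"
    using Suc by simp
  finally show ?case
    by (simp add: sum.distrib [symmetric] div_Suc dvd_eq_mod_eq_0 algebra_simps if_distrib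
        cong: if_cong)
qed

definition chebyshev_coeff :: "nat \<Rightarrow> real" where
  "chebyshev_coeff k =
     real k - real (k div 2) - real (k div 3) - real (k div 5) + real (k div 30)"

lemma chebyshev_coeff_mod_30: "chebyshev_coeff (k mod 30) = chebyshev_coeff k"
proof -
  define q r where "q = k div 30" and "r = k mod 30"
  have "k = 30 * q + r" "r < 30" by (simp_all add: q_def r_def)
  then have "k div 2 = 15 * q + r div 2" "k div 3 = 10 * q + r div 3" "k div 5 = 6 * q + r div 5"
    "k div 30 = q" "r div 30 = 0"
    by simp_all
  then have "chebyshev_coeff r = chebyshev_coeff k"
    using \<open>k = 30 * q + r\<close> unfolding chebyshev_coeff_def by simp
  then show ?thesis by (simp only: r_def)
qed

lemma chebyshev_coeff_in_0_1: "chebyshev_coeff k \<in> {0, 1}"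
proof -
  have "\<forall>r\<in>set [0..<30]. chebyshev_coeff r \<in> {0, 1}"
    by (simp add: chebyshev_coeff_def upt_rec)
  moreover have "k mod 30 \<in> set [0..<30]" by simp
  ultimately show ?thesis by (metis chebyshev_coeff_mod_30)
qed

lemma chebyshev_coeff_eq_1:
  assumes "1 \<le> k" "k < 6"
  shows "chebyshev_coeff k = 1"
proof -
  have "k \<in> {1, 2, 3, 4, 5}" using assms by auto
  then show ?thesis by (auto simp: chebyshev_coeff_def)
qed

definition chebyshev_combination :: "nat \<Rightarrow> real" where
  "chebyshev_combination n = ln (fact n) - ln (fact (n div 2)) - ln (fact (n div 3))
     - ln (fact (n div 5)) + ln (fact (n div 30))"

lemma chebyshev_combination_eq_sum_mangoldt:
  "chebyshev_combination n = (\<Sum>d=1..n. mangoldt d * chebyshev_coeff (n div d))"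
proof -
  have "ln (fact (n div k)) = (\<Sum>d=1..n. mangoldt d * real (n div d div k))" for k
    using ln_fact_eq_sum_mangoldt[of "n div k" n]
    by (simp add: div_mult2_eq [symmetric] mult.commute)
  moreover have "ln (fact n) = (\<Sum>d=1..n. mangoldt d * real (n div d))"
    by (rule ln_fact_eq_sum_mangoldt) simp
  ultimately show ?thesis
    unfolding chebyshev_combination_def chebyshev_coeff_def
    by (simp add: ring_distribs sum.distrib sum_subtractf)
qed

lemma chebyshev_combination_le_psi: "chebyshev_combination n \<le> chebyshev_psi n"
  unfolding chebyshev_combination_eq_sum_mangoldt chebyshev_psi_def
proof (intro sum_mono mult_left_le mangoldt_nonneg)
  fix d
  show "chebyshev_coeff (n div d) \<le> 1" using chebyshev_coeff_in_0_1[of "n div d"] by auto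
qed

lemma chebyshev_psi_diff_le_combination:
  "chebyshev_psi n - chebyshev_psi (n div 6) \<le> chebyshev_combination n"
proof -
  have "chebyshev_psi n - chebyshev_psi (n div 6) = (\<Sum>d\<in>{n div 6<..n}. mangoldt d)"
    by (rule chebyshev_psi_diff) simp
  also have "\<dots> = (\<Sum>d\<in>{n div 6<..n}. mangoldt d * chebyshev_coeff (n div d))"
  proof (intro sum.cong refl)
    fix d assume "d \<in> {n div 6<..n}"
    then have "0 < d" "d \<le> n" "n < 6 * d" by auto
    then have "1 \<le> n div d" "n div d < 6"
      by (auto simp: Suc_le_eq div_greater_zero_iff less_mult_imp_div_less)
    then show "mangoldt d = mangoldt d * chebyshev_coeff (n div d)"
      by (simp add: chebyshev_coeff_eq_1)
  qed
  also have "\<dots> \<le> (\<Sum>d=1..n. mangoldt d * chebyshev_coeff (n div d))"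
  proof (intro sum_mono2 mult_nonneg_nonneg mangoldt_nonneg)
    fix d
    show "0 \<le> chebyshev_coeff (n div d)" using chebyshev_coeff_in_0_1[of "n div d"] by auto
  qed auto
  finally show ?thesis unfolding chebyshev_combination_eq_sum_mangoldt .
qed

section \<open>Logarithms of factorials\<close>

lemma diff_le_mult_ln_diff:
  fixes x y :: real
  assumes "x > 0" "y > 0"
  shows "y - x \<le> y * (ln y - ln x)"
  using ln_diff_le[OF assms] assms by (simp add: field_simps)

lemma ln_fact_Suc: "ln (fact (Suc n)) = ln (real n + 1) + ln (fact n)"
  by (simp add: ln_mult add.commute)

lemma ln_fact_ge:
  assumes "n \<ge> 1"
  shows "n * ln n - n + 1 \<le> ln (fact n)"
  using assms
proof (induction n rule: dec_induct)
  case base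
  show ?case by simp
next
  case (step n)
  have "real n - (real n + 1) \<le> n * (ln n - ln (real n + 1))"
    using step.hyps by (intro diff_le_mult_ln_diff) auto
  moreover have "real (Suc n) = real n + 1" by simp
  ultimately show ?case using step.IH unfolding ln_fact_Suc by (simp only: algebra_simps)
qed

lemma ln_fact_le:
  assumes "n \<ge> 1"
  shows "ln (fact n) \<le> n * ln n - n + 1 + ln n"
  using assms
proof (induction n rule: dec_induct)
  case base
  show ?case by simp
next
  case (step n)
  have "(real n + 1) - n \<le> (real n + 1) * (ln (real n + 1) - ln n)"
    using step.hyps by (intro diff_le_mult_ln_diff) auto
  moreover have "real (Suc n) = real n + 1" by simp
  ultimately show ?case using step.IH unfolding ln_fact_Suc by (simp only: algebra_simps)
qed

lemma ln_fact_floor_approx: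
  fixes x :: real
  assumes "x > 0"
  shows "\<bar>ln (fact (nat \<lfloor>x\<rfloor>)) - (x * ln x - x + 1 / 2)\<bar> \<le> 1 / 2 + max 0 (ln x)"
proof (cases "x < 1")
  case True
  then have "ln (fact (nat \<lfloor>x\<rfloor>) :: real) = 0" "max 0 (ln x) = 0" "x * ln x \<le> 0"
    using assms by (simp_all add: mult_le_0_iff)
  moreover have "x - 1 \<le> x * ln x" using diff_le_mult_ln_diff[of 1 x] assms by simp
  ultimately show ?thesis using True assms by linarith
next
  case False
  define n where "n = nat \<lfloor>x\<rfloor>"
  have floor_bounds: "n \<ge> 1" "real n \<le> x" "x < real n + 1" using False unfolding n_def by linarith+
  have "x - n \<le> x * (ln x - ln n)" "n - x \<le> n * (ln n - ln x)"
    using assms floor_bounds by (intro diff_le_mult_ln_diff; simp)+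
  moreover have "(x - n) * ln n \<ge> 0" "(n + 1 - x) * ln x \<ge> 0"
    using False floor_bounds by (intro mult_nonneg_nonneg; simp)+
  moreover have "ln n \<le> ln x" "max 0 (ln x) = ln x" using floor_bounds False by simp_all
  ultimately show ?thesis
    using ln_fact_ge[OF floor_bounds(1)] ln_fact_le[OF floor_bounds(1)] unfolding n_def [symmetric]
    by (simp add: abs_le_iff algebra_simps)
qed

lemma ln_fact_div_approx:
  fixes n k :: nat
  assumes "k > 0" "n > 0"
  shows "\<bar>ln (fact (n div k)) - (n / k * (ln n - ln k) - n / k + 1 / 2)\<bar> \<le> 1 / 2 + ln n"
proof -
  define x where "x = real n / k"
  have "x > 0" using assms by (simp add: x_def)
  have floor_eq: "nat \<lfloor>x\<rfloor> = n div k" by (simp add: x_def floor_divide_of_nat_eq)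
  have ln_eq: "ln x = ln n - ln k" using assms by (simp add: x_def ln_div)
  have "max 0 (ln x) \<le> ln n" using assms by (simp add: ln_eq)
  with ln_fact_floor_approx[OF \<open>x > 0\<close>]
  have "\<bar>ln (fact (nat \<lfloor>x\<rfloor>)) - (x * ln x - x + 1 / 2)\<bar> \<le> 1 / 2 + ln n" by linarith
  then show ?thesis unfolding floor_eq ln_eq by (simp only: x_def)
qed

section \<open>Explicit bounds for Chebyshev's function\<close>

definition chebyshev_const :: real where
  "chebyshev_const = ln 2 / 2 + ln 3 / 3 + ln 5 / 5 - ln 30 / 30"

lemma chebyshev_const_eq_ln: "30 * chebyshev_const = ln (2 ^ 14 * 3 ^ 9 * 5 ^ 5)"
proof -
  have "ln (30 :: real) = ln (2 * 3 * 5)" by simp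
  also have "\<dots> = ln 2 + ln 3 + ln 5" by (simp only: ln_mult_pos zero_less_numeral mult_pos_pos)
  finally have "30 * chebyshev_const = 14 * ln 2 + 9 * ln 3 + 5 * ln 5"
    unfolding chebyshev_const_def by (simp add: field_simps)
  also have "\<dots> = ln (2 ^ 14 * 3 ^ 9 * 5 ^ 5)"
    by (simp only: ln_mult_pos zero_less_numeral zero_less_power mult_pos_pos ln_realpow
        of_nat_numeral)
  finally show ?thesis .
qed

lemma chebyshev_const_ge: "11 / 12 \<le> chebyshev_const"
proof -
  have "exp (55 :: real) = exp 1 ^ 55" by (simp add: exp_of_nat_mult [symmetric])
  also have "\<dots> \<le> (272 / 100) ^ 55" using e_less_272 by (intro power_mono) auto
  also have "\<dots> \<le> (2 ^ 14 * 3 ^ 9 * 5 ^ 5) ^ 2" by (simp add: power_divide)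
  finally have "55 \<le> ln ((2 ^ 14 * 3 ^ 9 * 5 ^ 5) ^ 2 :: real)" by (subst ln_ge_iff) auto
  also have "\<dots> = 2 * (30 * chebyshev_const)"
    unfolding chebyshev_const_eq_ln by (subst ln_realpow) auto
  finally show ?thesis by simp
qed

lemma chebyshev_const_le: "chebyshev_const \<le> 14 / 15"
proof -
  have "27 / 10 \<le> exp (1 :: real)" using abs_le_D2[OF e_approx_32] by simp
  have "2 ^ 14 * 3 ^ 9 * 5 ^ 5 \<le> (27 / 10 :: real) ^ 28" by (simp add: power_divide)
  also have "\<dots> \<le> exp 1 ^ 28" using \<open>27 / 10 \<le> exp 1\<close> by (intro power_mono) auto
  also have "\<dots> = exp (28 :: real)" by (simp add: exp_of_nat_mult [symmetric])
  finally have "ln (2 ^ 14 * 3 ^ 9 * 5 ^ 5) \<le> ln (exp (28 :: real))"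
    by (subst ln_le_cancel_iff) auto
  then show ?thesis using chebyshev_const_eq_ln by simp
qed

lemma ln_le_sqrt_minus_three_fifths:
  fixes x :: real
  assumes "x > 0"
  shows "ln x \<le> sqrt x - 3 / 5"
proof -
  have "ln (sqrt x) - ln 2 \<le> (sqrt x - 2) / 2" using assms by (intro ln_diff_le) auto
  moreover have "ln (sqrt x) = ln x / 2" using assms by (simp add: ln_sqrt)
  ultimately show ?thesis using ln2_le_25_over_36 by (simp add: field_simps)
qed

lemma chebyshev_combination_approx:
  "\<bar>chebyshev_combination n - chebyshev_const * n\<bar> \<le> 5 * sqrt n"
proof (cases "n = 0")
  case True
  then show ?thesis by (simp add: chebyshev_combination_def)
next
  case False
  have "\<bar>chebyshev_combination n - chebyshev_const * n + 1 / 2\<bar> \<le> 5 * (1 / 2 + ln n)"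
    using ln_fact_div_approx[of 1 n] ln_fact_div_approx[of 2 n] ln_fact_div_approx[of 3 n]
      ln_fact_div_approx[of 5 n] ln_fact_div_approx[of 30 n] False
    unfolding chebyshev_combination_def chebyshev_const_def
    by (simp add: abs_le_iff algebra_simps)
  then show ?thesis using ln_le_sqrt_minus_three_fifths[of n] False by (simp add: abs_le_iff)
qed

lemma chebyshev_psi_ge: "11 / 12 * n - 5 * sqrt n \<le> chebyshev_psi n"
proof -
  have "11 / 12 * real n \<le> chebyshev_const * n"
    using chebyshev_const_ge by (intro mult_right_mono) auto
  with chebyshev_combination_approx[of n] chebyshev_combination_le_psi[of n]
  show ?thesis by linarith
qed

text \<open>The factors are the fixed points of \<open>c = c / 6 + 14 / 15\<close> and of \<open>c = 4 c / 9 + 5\<close>.\<close>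

lemma chebyshev_psi_le: "chebyshev_psi n \<le> 28 / 25 * n + 9 * sqrt n"
proof (induction n rule: less_induct)
  case (less n)
  show ?case
  proof (cases "n = 0")
    case True
    then show ?thesis by (simp add: chebyshev_psi_def)
  next
    case False
    have "real (n div 6) \<le> n / 6" using of_nat_div_le_of_nat[of n 6, where ?'a = real] by simp
    moreover from this have "sqrt (n div 6) \<le> sqrt ((4 / 9)\<^sup>2 * n)"
      by (intro real_sqrt_le_mono) (simp add: power2_eq_square)
    then have "sqrt (n div 6) \<le> 4 / 9 * sqrt n" by (simp add: real_sqrt_mult)
    moreover have "chebyshev_psi (n div 6) \<le> 28 / 25 * (n div 6) + 9 * sqrt (n div 6)"
      using less False by simp
    moreover have "chebyshev_const * n \<le> 14 / 15 * n"
      using chebyshev_const_le by (intro mult_right_mono) auto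
    ultimately show ?thesis
      using chebyshev_psi_diff_le_combination[of n] chebyshev_combination_approx[of n]
      by linarith
  qed
qed

section \<open>Primes in short intervals\<close>

lemma sqrt_mult_ln_less_chebyshev_psi_diff:
  assumes "n \<ge> 127999" "4 * m \<le> 3 * n + 3"
  shows "sqrt n * ln n < chebyshev_psi n - chebyshev_psi m"
proof -
  define s where "s = sqrt n"
  have "s * s = n" by (simp add: s_def)
  have "s \<ge> 357" using assms(1) by (simp add: s_def real_le_rsqrt)
  have m_le: "real m \<le> 3 / 4 * (s * s) + 3 / 4" using assms(2) unfolding \<open>s * s = n\<close> by linarith
  also have "\<dots> \<le> (9 / 10 * s)\<^sup>2"
    using assms(1) \<open>s * s = n\<close> by (simp add: power2_eq_square)
  finally have "sqrt m \<le> 9 / 10 * s" using \<open>s \<ge> 357\<close> by (intro real_le_lsqrt) auto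
  have "ln s - ln 256 \<le> (s - 256) / 256" using \<open>s \<ge> 357\<close> by (intro ln_diff_le) auto
  moreover have "ln (256 :: real) = 8 * ln 2" using ln_realpow[of 2 8] by simp
  ultimately have "2 * ln s < 23 / 300 * s - 66 / 5"
    using ln2_le_25_over_36 \<open>s \<ge> 357\<close> by simp
  then have "s * (2 * ln s) < s * (23 / 300 * s - 66 / 5)"
    using \<open>s \<ge> 357\<close> by (intro mult_strict_left_mono) auto
  also have "\<dots> \<le> (11 / 12 * (s * s) - 5 * s)
      - (28 / 25 * (3 / 4 * (s * s) + 3 / 4) + 9 * (9 / 10 * s))"
    using \<open>s \<ge> 357\<close> by (simp add: algebra_simps)
  also have "\<dots> \<le> chebyshev_psi n - chebyshev_psi m"
    using chebyshev_psi_ge[of n] chebyshev_psi_le[of m] m_le \<open>sqrt m \<le> 9 / 10 * s\<close>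
    unfolding \<open>s * s = n\<close> s_def [symmetric] by argo
  finally show ?thesis using assms(1) by (simp add: s_def ln_sqrt)
qed

lemma ex_prime_between_4_thirds_large:
  fixes x :: real
  assumes "x \<ge> 96000"
  shows "\<exists>p :: nat. prime p \<and> x < p \<and> p < 4 / 3 * x"
proof -
  define m n where "m = nat \<lfloor>x\<rfloor>" and "n = nat (\<lceil>4 / 3 * x\<rceil> - 1)"
  have m_bounds: "real m \<le> x" "x < real m + 1"
    and n_bounds: "real n < 4 / 3 * x" "4 / 3 * x \<le> real n + 1"
    using assms unfolding m_def n_def by linarith+
  then have "n \<ge> 127999" "4 * m \<le> 3 * n + 3" using assms by linarith+
  then obtain p where "prime p" "m < p" "p \<le> n"
    using ex_prime_between_if_chebyshev_psi_diff_greater sqrt_mult_ln_less_chebyshev_psi_diff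
    by blast
  moreover from this have "x < p" "p < 4 / 3 * x" using m_bounds n_bounds by linarith+
  ultimately show ?thesis by blast
qed

lemma ex_prime_between_if_chain:
  fixes x c l :: real and ps :: "nat list"
  assumes "successively (\<lambda>p q. q < c * p) (l # map real ps)" "\<forall>p\<in>set ps. prime p"
    and "c > 0" "l \<le> x" "x < last (l # map real ps)"
  shows "\<exists>p :: nat. prime p \<and> x < p \<and> p < c * x"
  using assms
proof (induction ps arbitrary: l)
  case Nil
  then show ?case by simp
next
  case (Cons p ps)
  show ?case
  proof (cases "x < p")
    case True
    have "p < c * l" using Cons.prems(1) by simp
    also have "c * l \<le> c * x" using Cons.prems by simp
    finally show ?thesis using True Cons.prems(2) by auto
  next
    case False
    then show ?thesis using Cons.prems by (intro Cons.IH[of p]) auto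
  qed
qed

lemma prime_if_no_small_divisor:
  fixes p r :: nat
  assumes "1 < p" "p < r\<^sup>2" "list_all (\<lambda>k. \<not> k dvd p) [2..<r]"
  shows "prime p"
  unfolding prime_divisor_sqrt
proof (intro conjI allI impI)
  fix d assume small_divisor: "d dvd p \<and> d\<^sup>2 \<le> p"
  then have "d\<^sup>2 < r\<^sup>2" using assms(2) by linarith
  then have "d < r" by (rule power2_less_imp_less) simp
  moreover have "d > 0" using small_divisor assms(1) by (auto intro: Nat.gr0I)
  moreover have "\<not> 2 \<le> d" using small_divisor assms(3) \<open>d < r\<close> by (auto simp: list_all_iff)
  ultimately show "d = 1" by linarith
qed (use assms in simp)

lemma ex_prime_between_4_thirds:
  fixes x :: real
  assumes "x \<ge> 18"
  shows "\<exists>p :: nat. prime p \<and> x < p \<and> p < 4 / 3 * x"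
proof (cases "x \<ge> 96000")
  case True
  then show ?thesis by (rule ex_prime_between_4_thirds_large)
next
  case False
  \<comment> \<open>The second components exceed the square roots of the primes and bound the trial division.\<close>
  define bounded_primes :: "(nat \<times> nat) list" where "bounded_primes = [
    (23, 5), (29, 6), (37, 7), (47, 7), (61, 8), (79, 9), (103, 11), (137, 12), (181, 14),
    (241, 16), (317, 18), (421, 21), (557, 24), (739, 28), (983, 32), (1307, 37), (1741, 42),
    (2311, 49), (3079, 56), (4099, 65), (5449, 74), (7253, 86), (9661, 99), (12853, 114),
    (17137, 131), (22817, 152), (30403, 175), (40531, 202), (54037, 233), (72047, 269),
    (96059, 310)]"
  define ps where "ps = map fst bounded_primes"
  have "\<forall>(p, r)\<in>set bounded_primes. 1 < p \<and> p < r\<^sup>2 \<and> list_all (\<lambda>k. \<not> k dvd p) [2..<r]"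
    unfolding bounded_primes_def by simp
  then have "\<forall>p\<in>set ps. prime p" unfolding ps_def using prime_if_no_small_divisor by fastforce
  moreover have "successively (\<lambda>p q. q < 4 / 3 * p) (18 # map real ps)"
    "last (18 # map real ps) = 96059"
    by (simp_all add: ps_def bounded_primes_def)
  ultimately show ?thesis
    using ex_prime_between_if_chain[of "4 / 3" 18 ps x] assms False by simp
qed

lemma ex_prime_between_3_halves:
  fixes x :: real
  assumes "x \<ge> 12"
  shows "\<exists>p :: nat. prime p \<and> x < p \<and> p < 3 / 2 * x"
proof (cases "x \<ge> 18")
  case True
  then obtain p :: nat where "prime p" "x < p" "p < 4 / 3 * x"
    using ex_prime_between_4_thirds by blast
  moreover from this have "p < 3 / 2 * x" using True by linarith
  ultimately show ?thesis by blast
next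
  case False
  then show ?thesis using ex_prime_between_if_chain[of "3 / 2" 12 "[17, 19]" x] assms by simp
qed

theorem theorem6p4:
  fixes a n :: nat
  assumes "a > 0" and "n > 0" and "real n > 14.4 * real a"
  shows "\<exists>p q :: nat. prime p \<and> prime q \<and>
           real n < real (a * p) \<and> real (a * p) < 3 * real n / 2 \<and>
           3 * real n / 2 < real (a * q) \<and> real (a * q) < 2 * real n"
proof -
  define x where "x = real n / real a"
  have n_eq: "real n = a * x" using assms by (simp add: x_def)
  have "x > 14.4" using assms by (simp add: x_def field_simps)
  obtain p :: nat where p_between: "prime p" "x < p" "p < 3 / 2 * x"
    using ex_prime_between_3_halves[of x] \<open>x > 14.4\<close> by auto
  obtain q :: nat where q_between: "prime q" "3 / 2 * x < q" "q < 4 / 3 * (3 / 2 * x)"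
    using ex_prime_between_4_thirds[of "3 / 2 * x"] \<open>x > 14.4\<close> by auto
  have "a * x < a * real p" "a * real p < a * (3 / 2 * x)"
    "a * (3 / 2 * x) < a * real q" "a * real q < a * (2 * x)"
    using p_between q_between assms(1) by (intro mult_strict_left_mono; simp)+
  then have "real n < real (a * p)" "real (a * p) < 3 * real n / 2"
    "3 * real n / 2 < real (a * q)" "real (a * q) < 2 * real n"
    unfolding n_eq by simp_all
  with p_between(1) q_between(1) show ?thesis by blast
qed

end
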